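(* $\mathrm{DACA}(O(1)) = \mathrm{LT}$.
   Context: A cellular automaton (CA) is $C=(Q,\delta,\Sigma)$ with finite state set $Q$, local rule $\delta\colon Q^3\to Q$, input alphabet $\Sigma\subseteq Q$, and an inactive state $q\in Q\setminus\Sigma$ with $\delta(z_1,z_2,z_3)=q$ iff $z_2=q$; the global map is $\Delta(c)(z)=\delta(c(z-1),c(z),c(z+1))$ on $Q^{\mathbb{Z}}$. For input $w\in\Sigma^+$ the initial configuration $c_0$ has $c_0(i)=w(i)$ for $0\le i<|w|$ and $q$ elsewhere. For $F\subseteq Q\setminus\{q\}$, a configuration $\Delta^\tau(c_0)$ is $F$-final if all its cells are in $F\cup\{q\}$. A decider ACA (DACA) is a CA with nonempty disjoint sets $A,R\subseteq Q\setminus\{q\}$ of accept and reject states such that every input $w\in\Sigma^+$ leads to an $A$-final or an $R$-final configuration; $C$ accepts $w$ if it reaches an $A$-final configuration with no earlier $R$-final configuration, and rejects $w$ if it reaches an $R$-final configuration with no earlier $A$-final one. The time taken on $w$ is the number of steps until the first $A$- or $R$-final configuration. $L(C)$ is the set of accepted words. $\mathrm{DACA}(t)$ is the class of $L(C)$ for DACAs deciding every input $w$ within $t(|w|)$ steps; $\mathrm{DACA}(O(1))$ is the union over constant $t$. For a word $w$ and $k\in\mathbb{N}_0$, $p_k(w)$, $s_k(w)$, $I_k(w)$ denote the prefix, suffix, and set of infixes of length $k$ (with $p_k(w)=s_k(w)=w$, $I_k(w)=\{w\}$ if $k\ge|w|$). $L\subseteq\Sigma^*$ is locally testable if there is $k\in\mathbb{N}_+$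 such that $p_k(w_1)=p_k(w_2)$, $I_k(w_1)=I_k(w_2)$, $s_k(w_1)=s_k(w_2)$ imply $w_1\in L\iff w_2\in L$; $\mathrm{LT}$ is the class of such languages. The empty word is disregarded: all languages are considered as subsets of $\Sigma^+$. *)

theory Defs
  imports Main "HOL-Library.Sublist" "HOL-Library.Infinite_Typeclass"
begin

text \<open>
  State sets and alphabets are finite subsets of a common type of symbols, so that the input
  alphabet is literally a subset of the state set.  The local rule is a total function of which
  only the values on the state set matter.
\<close>

record 'a ca =
  states :: "'a set"
  rule :: "'a \<Rightarrow> 'a \<Rightarrow> 'a \<Rightarrow> 'a"
  alphabet :: "'a set"
  inactive :: 'a

definition is_ca :: "('a, 'b) ca_scheme \<Rightarrow> bool" where
  "is_ca C \<longleftrightarrow>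
     finite (states C) \<and>
     (\<forall>x\<in>states C. \<forall>y\<in>states C. \<forall>z\<in>states C. rule C x y z \<in> states C) \<and>
     alphabet C \<subseteq> states C \<and>
     inactive C \<in> states C - alphabet C \<and>
     (\<forall>x\<in>states C. \<forall>y\<in>states C. \<forall>z\<in>states C. rule C x y z = inactive C \<longleftrightarrow> y = inactive C)"

definition global_map :: "('a, 'b) ca_scheme \<Rightarrow> (int \<Rightarrow> 'a) \<Rightarrow> (int \<Rightarrow> 'a)" where
  "global_map C c = (\<lambda>z. rule C (c (z - 1)) (c z) (c (z + 1)))"

definition initial_config :: "('a, 'b) ca_scheme \<Rightarrow> 'a list \<Rightarrow> (int \<Rightarrow> 'a)" where
  "initial_config C w =
     (\<lambda>i. if 0 \<le> i \<and> i < int (length w) then w ! nat i else inactive C)"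

definition config_at :: "('a, 'b) ca_scheme \<Rightarrow> 'a list \<Rightarrow> nat \<Rightarrow> (int \<Rightarrow> 'a)" where
  "config_at C w \<tau> = (global_map C ^^ \<tau>) (initial_config C w)"

definition final_config :: "('a, 'b) ca_scheme \<Rightarrow> 'a set \<Rightarrow> (int \<Rightarrow> 'a) \<Rightarrow> bool" where
  "final_config C F c \<longleftrightarrow> (\<forall>z. c z \<in> F \<union> {inactive C})"

definition nonempty_words :: "'a set \<Rightarrow> 'a list set" where
  "nonempty_words S = lists S - {[]}"

record 'a daca = "'a ca" +
  accept_states :: "'a set"
  reject_states :: "'a set"

abbreviation accept_final_at :: "('a, 'b) daca_scheme \<Rightarrow> 'a list \<Rightarrow> nat \<Rightarrow> bool" where
  "accept_final_at C w \<tau> \<equiv> final_config C (accept_states C) (config_at C w \<tau>)"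

abbreviation reject_final_at :: "('a, 'b) daca_scheme \<Rightarrow> 'a list \<Rightarrow> nat \<Rightarrow> bool" where
  "reject_final_at C w \<tau> \<equiv> final_config C (reject_states C) (config_at C w \<tau>)"

definition is_daca :: "('a, 'b) daca_scheme \<Rightarrow> bool" where
  "is_daca C \<longleftrightarrow>
     is_ca C \<and>
     accept_states C \<noteq> {} \<and> reject_states C \<noteq> {} \<and>
     accept_states C \<inter> reject_states C = {} \<and>
     accept_states C \<subseteq> states C - {inactive C} \<and>
     reject_states C \<subseteq> states C - {inactive C} \<and>
     (\<forall>w\<in>nonempty_words (alphabet C). \<exists>\<tau>. accept_final_at C w \<tau> \<or> reject_final_at C w \<tau>)"

definition accepts :: "('a, 'b) daca_scheme \<Rightarrow> 'a list \<Rightarrow> bool" where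
  "accepts C w \<longleftrightarrow> (\<exists>\<tau>. accept_final_at C w \<tau> \<and> (\<forall>\<tau>'<\<tau>. \<not> reject_final_at C w \<tau>'))"

definition language :: "('a, 'b) daca_scheme \<Rightarrow> 'a list set" where
  "language C = {w \<in> nonempty_words (alphabet C). accepts C w}"

definition decision_time :: "('a, 'b) daca_scheme \<Rightarrow> 'a list \<Rightarrow> nat" where
  "decision_time C w = (LEAST \<tau>. accept_final_at C w \<tau> \<or> reject_final_at C w \<tau>)"

definition DACA :: "'a set \<Rightarrow> (nat \<Rightarrow> nat) \<Rightarrow> 'a list set set" where
  "DACA \<Sigma> t = {language C | C :: 'a daca.
     is_daca C \<and> alphabet C = \<Sigma> \<and>
     (\<forall>w\<in>nonempty_words \<Sigma>. decision_time C w \<le> t (length w))}"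

definition DACA_const :: "'a set \<Rightarrow> 'a list set set" where
  "DACA_const \<Sigma> = (\<Union>b. DACA \<Sigma> (\<lambda>_. b))"

definition pref :: "nat \<Rightarrow> 'a list \<Rightarrow> 'a list" where
  "pref k w = take k w"

definition suff :: "nat \<Rightarrow> 'a list \<Rightarrow> 'a list" where
  "suff k w = drop (length w - k) w"

definition infixes :: "nat \<Rightarrow> 'a list \<Rightarrow> 'a list set" where
  "infixes k w = (if length w \<le> k then {w} else {u. length u = k \<and> sublist u w})"

definition locally_testable :: "'a set \<Rightarrow> 'a list set \<Rightarrow> bool" where
  "locally_testable \<Sigma> L \<longleftrightarrow>
     L \<subseteq> lists \<Sigma> \<and>
     (\<exists>k>0. \<forall>w\<^sub>1\<in>lists \<Sigma>. \<forall>w\<^sub>2\<in>lists \<Sigma>.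
        pref k w\<^sub>1 = pref k w\<^sub>2 \<and> infixes k w\<^sub>1 = infixes k w\<^sub>2 \<and> suff k w\<^sub>1 = suff k w\<^sub>2
        \<longrightarrow> (w\<^sub>1 \<in> L \<longleftrightarrow> w\<^sub>2 \<in> L))"

definition LT :: "'a set \<Rightarrow> 'a list set set" where
  "LT \<Sigma> = {L. L \<subseteq> nonempty_words \<Sigma> \<and> locally_testable \<Sigma> L}"

end

theory Submission
  imports Defs
begin

text \<open>
  Pad a word with inactive cells on both sides and let its \<^emph>\<open>window set\<close> of radius \<open>r\<close> be the set
  of factors of length \<open>2 r + 1\<close> centred at the cells of the word.  Window sets carry the same
  information as prefix, suffix and infixes of bounded length.

  The set of states at time \<open>\<tau>\<close> depends only on the window set of radius \<open>\<tau>\<close>, and whether a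
  configuration is final depends only on its set of states; hence constant-time languages are locally
  testable.

  Conversely, every cell can collect its own window, but no cell learns the window set of the word.
  Enumerate all candidate window sets \<open>V\<^sub>0, V\<^sub>1, \<dots>\<close> by increasing cardinality, and in step \<open>k + i\<close>
  let a cell be in an accept or reject state, according to the status of \<open>V\<^sub>i\<close>, iff its window is
  in \<open>V\<^sub>i\<close>.  The first final configuration belongs to the first \<open>V\<^sub>i\<close> that includes the window
  set of the word, and because of the order of enumeration this \<open>V\<^sub>i\<close> is the window set itself.
\<close>

section \<open>Windows of padded words\<close>

definition padded :: "'a \<Rightarrow> 'a list \<Rightarrow> int \<Rightarrow> 'a" where
  "padded q w = (\<lambda>i. if 0 \<le> i \<and> i < int (length w) then w ! nat i else q)"

definition window :: "nat \<Rightarrow> (int \<Rightarrow> 'a) \<Rightarrow> int \<Rightarrow> 'a list" where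
  "window r c z = map (\<lambda>i. c (z + int i - int r)) [0..<2 * r + 1]"

definition windows :: "'a \<Rightarrow> nat \<Rightarrow> 'a list \<Rightarrow> 'a list set" where
  "windows q r w = window r (padded q w) ` {0..<int (length w)}"

lemma initial_config_eq_padded: "initial_config C w = padded (inactive C) w"
  by (simp add: initial_config_def padded_def)

lemma length_window [simp]: "length (window r c z) = 2 * r + 1"
  by (simp add: window_def)

lemma window_eq_iff:
  "window r c z = window r c' z' \<longleftrightarrow> (\<forall>d. \<bar>d\<bar> \<le> int r \<longrightarrow> c (z + d) = c' (z' + d))"
proof
  assume eq: "window r c z = window r c' z'"
  show "\<forall>d. \<bar>d\<bar> \<le> int r \<longrightarrow> c (z + d) = c' (z' + d)"
  proof (intro allI impI)
    fix d assume d: "\<bar>d\<bar> \<le> int r"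
    have "window r c z ! nat (d + int r) = window r c' z' ! nat (d + int r)"
      by (simp add: eq)
    moreover have "nat (d + int r) < 2 * r + 1" using d by linarith
    moreover have "z + int (nat (d + int r)) - int r = z + d"
      "z' + int (nat (d + int r)) - int r = z' + d" using d by auto
    ultimately show "c (z + d) = c' (z' + d)"
      by (simp add: window_def del: upt_Suc)
  qed
next
  assume eq: "\<forall>d. \<bar>d\<bar> \<le> int r \<longrightarrow> c (z + d) = c' (z' + d)"
  show "window r c z = window r c' z'"
    unfolding window_def
  proof (rule map_cong[OF refl])
    fix i assume "i \<in> set [0..<2 * r + 1]"
    then have "\<bar>int i - int r\<bar> \<le> int r" by auto
    with eq have "c (z + (int i - int r)) = c' (z' + (int i - int r))" by blast
    then show "c (z + int i - int r) = c' (z' + int i - int r)" by (simp add: algebra_simps)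
  qed
qed

lemma windows_subsetE:
  assumes "windows q r w\<^sub>1 \<subseteq> windows q r w\<^sub>2" "0 \<le> z" "z < int (length w\<^sub>1)"
  obtains z' where "0 \<le> z'" "z' < int (length w\<^sub>2)"
    "\<And>d. \<bar>d\<bar> \<le> int r \<Longrightarrow> padded q w\<^sub>1 (z + d) = padded q w\<^sub>2 (z' + d)"
proof -
  have "window r (padded q w\<^sub>1) z \<in> windows q r w\<^sub>2"
    using assms by (auto simp: windows_def)
  then show thesis
    using that by (auto simp: windows_def window_eq_iff)
qed

section \<open>From prefix, infixes and suffix to window sets\<close>

lemma infixes_eq_take_drop:
  assumes "k \<le> length w"
  shows "infixes k w = {take k (drop n w) | n. n + k \<le> length w}" (is "_ = ?R")
proof -
  \<comment> \<open>At \<open>length w = k\<close> the definition takes its clause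
    \<open>{w}\<close>; this fact makes both clauses agree there.\<close>
  have "u = w" if "sublist u w" "length u = length w" for u
    using that by (auto simp: sublist_def)
  then have "infixes k w = {u. length u = k \<and> sublist u w}"
    using assms by (cases "length w = k") (auto simp: infixes_def)
  also have "\<dots> = ?R"
  proof (intro equalityI subsetI)
    fix u assume "u \<in> {u. length u = k \<and> sublist u w}"
    then obtain xs ys where "w = xs @ u @ ys" "length u = k" by (auto simp: sublist_def)
    then have "u = take k (drop (length xs) w)" "length xs + k \<le> length w" by auto
    then show "u \<in> ?R" by blast
  next
    fix u assume "u \<in> ?R"
    then obtain n where n: "u = take k (drop n w)" "n + k \<le> length w" by blast
    have "sublist u w"
      unfolding n(1) using sublist_order.order.trans[OF sublist_take sublist_drop] .
    with n show "u \<in> {u. length u = k \<and> sublist u w}" by simp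
  qed
  finally show ?thesis .
qed

text \<open>A prefix of length below \<open>k\<close> cannot result from cutting, so it is the whole
  word on both sides.\<close>

lemma pref_eq_short:
  assumes "pref k w\<^sub>1 = pref k w\<^sub>2" "length w\<^sub>1 < k"
  shows "w\<^sub>1 = w\<^sub>2"
  using assms unfolding pref_def
  by (metis length_take less_imp_le_nat min_def not_less take_all)

text \<open>A window that overhangs the left end is read off the prefix, one that overhangs the
  right end off the suffix, and any other is itself an infix of length
  \<open>2 * r + 1\<close>.\<close>

lemma windows_subset_if_same_infixes:
  assumes pref: "pref (2 * r + 1) w\<^sub>1 = pref (2 * r + 1) w\<^sub>2"
    and inf: "infixes (2 * r + 1) w\<^sub>1 = infixes (2 * r + 1) w\<^sub>2"
    and suff: "suff (2 * r + 1) w\<^sub>1 = suff (2 * r + 1) w\<^sub>2"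
  shows "windows q r w\<^sub>1 \<subseteq> windows q r w\<^sub>2"
proof (cases "length w\<^sub>1 < 2 * r + 1 \<or> length w\<^sub>2 < 2 * r + 1")
  case True
  then have "w\<^sub>1 = w\<^sub>2" using pref_eq_short[OF pref] pref_eq_short[OF pref[symmetric]] by auto
  then show ?thesis by simp
next
  case False
  define n\<^sub>1 n\<^sub>2 where n: "n\<^sub>1 = length w\<^sub>1" "n\<^sub>2 = length w\<^sub>2"
  have len: "2 * r + 1 \<le> n\<^sub>1" "2 * r + 1 \<le> n\<^sub>2" using False by (auto simp: n)
  have "\<exists>z'\<in>{0..<int n\<^sub>2}. window r (padded q w\<^sub>1) z = window r (padded q w\<^sub>2) z'"
    if z: "0 \<le> z" "z < int n\<^sub>1" for z
  proof -
    consider "z < int r" | "int n\<^sub>1 - int r \<le> z" | "int r \<le> z" "z < int n\<^sub>1 - int r"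
      by linarith
    then show ?thesis
    proof cases
      case 1
      \<comment> \<open>Negative positions hold \<open>q\<close> in both words, and a window centred
        at \<open>z < r\<close> ends before position \<open>2 * r\<close>, so \<open>z\<close>
        itself is the witness.\<close>
      have "padded q w\<^sub>1 i = padded q w\<^sub>2 i" if "i < 2 * int r + 1" for i
      proof (cases "i < 0")
        case False
        then have "nat i < 2 * r + 1" using that by linarith
        then have "w\<^sub>1 ! nat i = w\<^sub>2 ! nat i"
          using pref unfolding pref_def by (metis nth_take)
        then show ?thesis using False that len by (auto simp: padded_def n)
      qed (simp add: padded_def)
      then show ?thesis
        using 1 z len by (intro bexI[of _ z]) (auto simp: window_eq_iff)
    next
      case 2
      \<comment> \<open>Positions are counted from the right end; the witness is the cell of
        \<open>w\<^sub>2\<close> at the same distance from its end.\<close>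
      have "padded q w\<^sub>1 (int n\<^sub>1 + i) = padded q w\<^sub>2 (int n\<^sub>2 + i)" if "- (2 * int r + 1) \<le> i" for i
      proof (cases "i < 0")
        case True
        define j where "j = nat (2 * int r + 1 + i)"
        have j: "nat (int n\<^sub>1 + i) = n\<^sub>1 - (2 * r + 1) + j" "nat (int n\<^sub>2 + i) = n\<^sub>2 - (2 * r + 1) + j"
          using that len by (auto simp: j_def)
        have "suff (2 * r + 1) w\<^sub>1 ! j = suff (2 * r + 1) w\<^sub>2 ! j" by (simp only: suff)
        then have "w\<^sub>1 ! nat (int n\<^sub>1 + i) = w\<^sub>2 ! nat (int n\<^sub>2 + i)"
          unfolding j suff_def using len by (simp add: n)
        then show ?thesis using True that len by (auto simp: padded_def n)
      qed (simp add: padded_def n)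
      from this[of "z - int n\<^sub>1 + d" for d] show ?thesis
        using 2 z len by (intro bexI[of _ "z - int n\<^sub>1 + int n\<^sub>2"])
          (auto simp: window_eq_iff algebra_simps)
    next
      case 3
      \<comment> \<open>\<open>m\<close> is where the window starts in \<open>w\<^sub>1\<close>; its
        centre lies \<open>r\<close> further right, and likewise for the occurrence at
        \<open>m'\<close>.\<close>
      define m where "m = nat (z - int r)"
      have m: "z = int m + int r" "m + (2 * r + 1) \<le> n\<^sub>1" using 3 by (auto simp: m_def)
      then have "take (2 * r + 1) (drop m w\<^sub>1) \<in> infixes (2 * r + 1) w\<^sub>2"
        using len infixes_eq_take_drop[of "2 * r + 1" w\<^sub>1] inf by (auto simp: n)
      then obtain m' where m': "m' + (2 * r + 1) \<le> n\<^sub>2"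
        and eq: "take (2 * r + 1) (drop m w\<^sub>1) = take (2 * r + 1) (drop m' w\<^sub>2)"
        using len infixes_eq_take_drop[of "2 * r + 1" w\<^sub>2] by (auto simp: n)
      have "padded q w\<^sub>1 (int m + int r + d) = padded q w\<^sub>2 (int m' + int r + d)"
        if d: "\<bar>d\<bar> \<le> int r" for d
      proof -
        define j where "j = nat (int r + d)"
        have j: "int r + d = int j" "j < 2 * r + 1" using d by (auto simp: j_def)
        have "take (2 * r + 1) (drop m w\<^sub>1) ! j = take (2 * r + 1) (drop m' w\<^sub>2) ! j"
          by (simp only: eq)
        then have "w\<^sub>1 ! (m + j) = w\<^sub>2 ! (m' + j)"
          using j m m' by (simp add: n)
        moreover have "int m + int r + d = int (m + j)" "int m' + int r + d = int (m' + j)"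
          using j by auto
        ultimately show ?thesis using j m m' by (simp only: padded_def n nat_int) auto
      qed
      then show ?thesis
        using m m' by (intro bexI[of _ "int m' + int r"]) (auto simp: window_eq_iff)
    qed
  qed
  then show ?thesis by (force simp: windows_def n)
qed

section \<open>Recovering prefix, suffix and infixes from window sets\<close>

lemma take_eq_if_padded_eq:
  assumes eq: "\<And>i. i < k \<Longrightarrow> padded q w\<^sub>1 (int i) = padded q w\<^sub>2 (int i)"
    and q: "q \<notin> set w\<^sub>1" "q \<notin> set w\<^sub>2"
  shows "take k w\<^sub>1 = take k w\<^sub>2"
proof -
  \<comment> \<open>As \<open>q\<close> is not a letter of either word, reading \<open>q\<close>
    means that the word has ended.\<close>
  have lens: "i < length w\<^sub>1 \<longleftrightarrow> i < length w\<^sub>2" if "i < k" for i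
    using eq[OF that] q by (auto simp: padded_def split: if_splits)
  show ?thesis
  proof (rule nth_equalityI)
    show "length (take k w\<^sub>1) = length (take k w\<^sub>2)"
      using lens[of "length w\<^sub>1"] lens[of "length w\<^sub>2"] unfolding length_take by linarith
    fix i assume "i < length (take k w\<^sub>1)"
    then show "take k w\<^sub>1 ! i = take k w\<^sub>2 ! i"
      using eq[of i] lens[of i] by (auto simp: padded_def)
  qed
qed

text \<open>The first cell is the only cell of the word with left neighbour \<open>q\<close>, so its
  window is recognizable in the window set, and the right half of that window shows the first
  \<open>k\<close> letters. Seeing the neighbour takes radius at least 1.\<close>

lemma pref_eq_if_windows_eq:
  assumes k: "0 < k" and q: "q \<notin> set w\<^sub>1" "q \<notin> set w\<^sub>2"
    and eq: "windows q k w\<^sub>1 = windows q k w\<^sub>2"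
  shows "pref k w\<^sub>1 = pref k w\<^sub>2"
proof (cases "w\<^sub>1 = []")
  case True
  then show ?thesis using eq by (auto simp: windows_def)
next
  case False
  obtain z where z: "0 \<le> z" "z < int (length w\<^sub>2)"
    and pad: "\<And>d. \<bar>d\<bar> \<le> int k \<Longrightarrow> padded q w\<^sub>1 (0 + d) = padded q w\<^sub>2 (z + d)"
    using windows_subsetE[of q k w\<^sub>1 w\<^sub>2 0] eq False by auto
  have "padded q w\<^sub>2 (z - 1) = q"
    using pad[of "-1"] k by (simp add: padded_def)
  then have "z = 0"
    using z q by (auto simp: padded_def split: if_splits)
  then show ?thesis
    unfolding pref_def using pad q by (intro take_eq_if_padded_eq[of _ q]) auto
qed

lemma padded_rev: "padded q (rev w) i = padded q w (int (length w) - 1 - i)"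
proof -
  have "nat (int (length w) - 1 - i) = length w - Suc (nat i)" if "0 \<le> i" "i < int (length w)"
    using that by auto
  then show ?thesis by (auto simp: padded_def rev_nth)
qed

text \<open>Serves to derive the statement on suffixes from the one on prefixes.\<close>

lemma windows_rev: "windows q r (rev w) = rev ` windows q r w"
proof -
  have *: "window r (padded q (rev w)) z = rev (window r (padded q w) (int (length w) - 1 - z))" for z
    by (rule nth_equalityI)
      (auto simp: window_def padded_rev rev_nth algebra_simps simp del: upt_Suc)
  have refl: "(\<lambda>z. int (length w) - 1 - z) ` {0..<int (length w)} = {0..<int (length w)}"
    by (auto simp: image_iff)
  have "windows q r (rev w) = (\<lambda>z. rev (window r (padded q w) z)) `
      (\<lambda>z. int (length w) - 1 - z) ` {0..<int (length w)}"
    unfolding windows_def image_image * length_rev ..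
  then show ?thesis unfolding refl windows_def image_image .
qed

lemma suff_eq_rev_pref: "suff k w = rev (pref k (rev w))"
  by (simp add: suff_def pref_def take_rev)

lemma suff_eq_if_windows_eq:
  assumes "0 < k" "q \<notin> set w\<^sub>1" "q \<notin> set w\<^sub>2" "windows q k w\<^sub>1 = windows q k w\<^sub>2"
  shows "suff k w\<^sub>1 = suff k w\<^sub>2"
  using pref_eq_if_windows_eq[of k q "rev w\<^sub>1" "rev w\<^sub>2"] assms
  by (simp add: suff_eq_rev_pref windows_rev)

text \<open>The window centred at the first cell of an infix shows the whole infix in its right
  half, so an equal window in \<open>w\<^sub>2\<close> yields an occurrence there.\<close>

lemma infixes_subset_if_windows_subset:
  assumes k: "0 < k" and q: "q \<notin> set w\<^sub>1"
    and sub: "windows q k w\<^sub>1 \<subseteq> windows q k w\<^sub>2"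
    and len: "k \<le> length w\<^sub>1" "k \<le> length w\<^sub>2"
  shows "infixes k w\<^sub>1 \<subseteq> infixes k w\<^sub>2"
proof
  fix u assume "u \<in> infixes k w\<^sub>1"
  then obtain n where u: "u = take k (drop n w\<^sub>1)" and n: "n + k \<le> length w\<^sub>1"
    using infixes_eq_take_drop len by blast
  obtain z where z: "0 \<le> z" "z < int (length w\<^sub>2)"
    and pad: "\<And>d. \<bar>d\<bar> \<le> int k \<Longrightarrow> padded q w\<^sub>1 (int n + d) = padded q w\<^sub>2 (z + d)"
    using windows_subsetE[of q k w\<^sub>1 w\<^sub>2 "int n"] sub n k by auto
  obtain m where m: "z = int m" using z nonneg_int_cases by blast
  have pad': "w\<^sub>1 ! (n + i) = padded q w\<^sub>2 (int (m + i))" if "i < k" for i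
    using pad[of "int i"] that n m by (auto simp: padded_def nat_int_add)
  \<comment> \<open>The last letter of the infix differs from \<open>q\<close>, so its copy does not
    run past the end of \<open>w\<^sub>2\<close>.\<close>
  have "padded q w\<^sub>2 (int (m + (k - 1))) \<noteq> q"
    using pad'[of "k - 1"] k n q nth_mem[of "n + (k - 1)" w\<^sub>1] by auto
  then have mk: "m + k \<le> length w\<^sub>2"
    using k by (auto simp: padded_def split: if_splits)
  have "u = take k (drop m w\<^sub>2)"
    unfolding u using n mk pad' by (intro nth_equalityI) (auto simp: padded_def nat_int_add)
  then show "u \<in> infixes k w\<^sub>2"
    using infixes_eq_take_drop[OF len(2)] mk by blast
qed

lemma infixes_eq_if_windows_eq:
  assumes "0 < k" "q \<notin> set w\<^sub>1" "q \<notin> set w\<^sub>2" "windows q k w\<^sub>1 = windows q k w\<^sub>2"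
  shows "infixes k w\<^sub>1 = infixes k w\<^sub>2"
proof (cases "length w\<^sub>1 < k \<or> length w\<^sub>2 < k")
  case True
  have "pref k w\<^sub>1 = pref k w\<^sub>2" using assms by (rule pref_eq_if_windows_eq)
  then have "w\<^sub>1 = w\<^sub>2" using True pref_eq_short[of k w\<^sub>1 w\<^sub>2] pref_eq_short[of k w\<^sub>2 w\<^sub>1] by auto
  then show ?thesis by simp
next
  case False
  then show ?thesis using assms by (intro equalityI infixes_subset_if_windows_subset) auto
qed

section \<open>Constant-time languages are locally testable\<close>

lemma config_at_eq_if_window_eq:
  assumes "window r (initial_config C w\<^sub>1) z\<^sub>1 = window r (initial_config C w\<^sub>2) z\<^sub>2" "\<tau> \<le> r"
  shows "config_at C w\<^sub>1 \<tau> z\<^sub>1 = config_at C w\<^sub>2 \<tau> z\<^sub>2"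
proof -
  \<comment> \<open>Shrinking the radius to exactly \<tau> makes the induction work: the balls of
    radius \<tau> around a cell and its two neighbours lie in the ball of radius \<tau> + 1.\<close>
  have "config_at C w\<^sub>1 \<tau> z\<^sub>1 = config_at C w\<^sub>2 \<tau> z\<^sub>2"
    if "\<forall>d. \<bar>d\<bar> \<le> int \<tau> \<longrightarrow> initial_config C w\<^sub>1 (z\<^sub>1 + d) = initial_config C w\<^sub>2 (z\<^sub>2 + d)"
    using that
  proof (induction \<tau> arbitrary: z\<^sub>1 z\<^sub>2)
    case 0
    then show ?case by (auto simp: config_at_def)
  next
    case (Suc \<tau>)
    have "config_at C w\<^sub>1 \<tau> (z\<^sub>1 + e) = config_at C w\<^sub>2 \<tau> (z\<^sub>2 + e)" if "\<bar>e\<bar> \<le> 1" for e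
    proof (rule Suc.IH, intro allI impI)
      fix d assume "\<bar>d\<bar> \<le> int \<tau>"
      then have "\<bar>e + d\<bar> \<le> int (Suc \<tau>)" using that by linarith
      with Suc.prems show "initial_config C w\<^sub>1 (z\<^sub>1 + e + d) = initial_config C w\<^sub>2 (z\<^sub>2 + e + d)"
        by (metis add.assoc)
    qed
    from this[of "-1"] this[of 0] this[of 1] show ?case
      by (simp add: config_at_def global_map_def)
  qed
  then show ?thesis using assms by (auto simp: window_eq_iff)
qed

text \<open>\<open>is_ca\<close> constrains the rule on the state set only, so this invariant must
  hold before its clauses can be applied to a configuration.\<close>

lemma config_at_in_states:
  assumes "is_ca C" "w \<in> lists (alphabet C)"
  shows "config_at C w \<tau> z \<in> states C"
proof (induction \<tau> arbitrary: z)
  case 0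
  show ?case
  proof (cases "0 \<le> z \<and> z < int (length w)")
    case True
    then have "w ! nat z \<in> set w" by (auto intro: nth_mem)
    then show ?thesis using True assms by (auto simp: config_at_def initial_config_def is_ca_def)
  qed (use assms in \<open>auto simp: config_at_def initial_config_def is_ca_def\<close>)
next
  case (Suc \<tau>)
  then show ?case using assms(1) by (simp add: config_at_def global_map_def is_ca_def)
qed

lemma config_at_outside:
  assumes "is_ca C" "w \<in> lists (alphabet C)" "z < 0 \<or> int (length w) \<le> z"
  shows "config_at C w \<tau> z = inactive C"
proof (induction \<tau>)
  case 0
  then show ?case using assms(3) by (auto simp: config_at_def initial_config_def)
next
  case (Suc \<tau>)
  have "config_at C w (Suc \<tau>) z =
      rule C (config_at C w \<tau> (z - 1)) (config_at C w \<tau> z) (config_at C w \<tau> (z + 1))"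
    by (simp add: config_at_def global_map_def)
  then show ?case
    using Suc config_at_in_states[OF assms(1,2)] assms(1) unfolding is_ca_def by metis
qed

text \<open>Finality is a condition on each single cell, and at time \<tau> every cell of
  \<open>w\<^sub>1\<close> has the state of some cell of \<open>w\<^sub>2\<close>.\<close>

lemma final_config_if_windows_subset:
  assumes C: "is_ca C" and w: "w\<^sub>1 \<in> lists (alphabet C)"
    and sub: "windows (inactive C) r w\<^sub>1 \<subseteq> windows (inactive C) r w\<^sub>2"
    and "\<tau> \<le> r" and final: "final_config C F (config_at C w\<^sub>2 \<tau>)"
  shows "final_config C F (config_at C w\<^sub>1 \<tau>)"
  unfolding final_config_def
proof
  fix z
  show "config_at C w\<^sub>1 \<tau> z \<in> F \<union> {inactive C}"
  proof (cases "0 \<le> z \<and> z < int (length w\<^sub>1)")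
    case True
    then have "window r (initial_config C w\<^sub>1) z \<in> windows (inactive C) r w\<^sub>2"
      using sub by (auto simp: windows_def initial_config_eq_padded)
    then obtain z' where "window r (initial_config C w\<^sub>1) z = window r (initial_config C w\<^sub>2) z'"
      by (auto simp: windows_def initial_config_eq_padded)
    then show ?thesis
      using config_at_eq_if_window_eq[OF _ \<open>\<tau> \<le> r\<close>] final by (metis final_config_def)
  next
    case False
    then show ?thesis using config_at_outside[OF C w] by auto
  qed
qed

text \<open>Confines acceptance to the times that windows of radius \<open>b\<close>
  control.\<close>

lemma accepts_iff_bounded:
  assumes C: "is_daca C" and w: "w \<in> nonempty_words (alphabet C)" and time: "decision_time C w \<le> b"
  shows "accepts C w \<longleftrightarrow>
    (\<exists>\<tau>\<le>b. accept_final_at C w \<tau> \<and> (\<forall>\<tau>'<\<tau>. \<not> reject_final_at C w \<tau>'))"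
proof
  let ?d = "decision_time C w"
  have "\<exists>\<tau>. accept_final_at C w \<tau> \<or> reject_final_at C w \<tau>"
    using C w by (auto simp: is_daca_def)
  then have d: "accept_final_at C w ?d \<or> reject_final_at C w ?d"
    unfolding decision_time_def by (rule LeastI_ex)
  have before: "\<not> reject_final_at C w \<tau>" if "\<tau> < ?d" for \<tau>
    using not_less_Least[of \<tau>] that unfolding decision_time_def by blast
  assume "accepts C w"
  then obtain \<tau> where \<tau>: "accept_final_at C w \<tau>" "\<forall>\<tau>'<\<tau>. \<not> reject_final_at C w \<tau>'"
    by (auto simp: accepts_def)
  show "\<exists>\<tau>\<le>b. accept_final_at C w \<tau> \<and> (\<forall>\<tau>'<\<tau>. \<not> reject_final_at C w \<tau>')"
  proof (cases "?d < \<tau>")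
    \<comment> \<open>The configuration at time \<open>?d\<close> is final but, as
      \<open>?d < \<tau>\<close>, not reject-final; so \<open>?d\<close> is the bounded
      witness.\<close>
    case True
    then show ?thesis using d before \<tau> time by blast
  next
    case False
    then show ?thesis using \<tau> time by (meson le_trans not_less)
  qed
qed (auto simp: accepts_def)

lemma DACA_const_subset_LT: "DACA_const \<Sigma> \<subseteq> LT \<Sigma>"
proof
  fix L assume "L \<in> DACA_const \<Sigma>"
  then obtain b and C :: "'a daca" where L: "L = language C" and C: "is_daca C" "alphabet C = \<Sigma>"
    and time: "\<And>w. w \<in> nonempty_words \<Sigma> \<Longrightarrow> decision_time C w \<le> b"
    by (auto simp: DACA_const_def DACA_def)
  have ca: "is_ca C" using C by (simp add: is_daca_def)
  \<comment> \<open>The length of a window of radius \<open>b\<close>.\<close>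
  let ?k = "2 * b + 1"
  have test: "w\<^sub>1 \<in> L \<longleftrightarrow> w\<^sub>2 \<in> L"
    if w: "w\<^sub>1 \<in> lists \<Sigma>" "w\<^sub>2 \<in> lists \<Sigma>" and pref: "pref ?k w\<^sub>1 = pref ?k w\<^sub>2"
      and inf: "infixes ?k w\<^sub>1 = infixes ?k w\<^sub>2" and suff: "suff ?k w\<^sub>1 = suff ?k w\<^sub>2" for w\<^sub>1 w\<^sub>2
  proof (cases "w\<^sub>1 = [] \<or> w\<^sub>2 = []")
    \<comment> \<open>Local testability also ranges over the empty word, whereas deciders are only
      required to decide nonempty ones; as \<open>?k\<close> is positive, the prefix tells it
      apart.\<close>
    case True
    then have "w\<^sub>1 = w\<^sub>2" using pref by (auto simp: pref_def)
    then show ?thesis by simp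
  next
    case False
    then have ne: "w\<^sub>1 \<in> nonempty_words \<Sigma>" "w\<^sub>2 \<in> nonempty_words \<Sigma>"
      using w by (auto simp: nonempty_words_def)
    have sub: "windows (inactive C) b w\<^sub>1 \<subseteq> windows (inactive C) b w\<^sub>2"
      "windows (inactive C) b w\<^sub>2 \<subseteq> windows (inactive C) b w\<^sub>1"
      using pref inf suff by (intro windows_subset_if_same_infixes; simp)+
    have final: "final_config C F (config_at C w\<^sub>1 \<tau>) \<longleftrightarrow> final_config C F (config_at C w\<^sub>2 \<tau>)"
      if "\<tau> \<le> b" for F \<tau>
      using final_config_if_windows_subset[OF ca] sub w that C(2) by blast
    have "accepts C w\<^sub>1 \<longleftrightarrow> accepts C w\<^sub>2"
      using accepts_iff_bounded[OF C(1)] ne time C(2) final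
      by (smt (verit, ccfv_SIG) less_imp_le_nat order_trans)
    then show ?thesis using ne C(2) by (auto simp: L language_def)
  qed
  have L_sub: "L \<subseteq> nonempty_words \<Sigma>" by (auto simp: L language_def C(2))
  moreover have "locally_testable \<Sigma> L"
    unfolding locally_testable_def
  proof (intro conjI exI[of _ ?k] ballI impI)
    show "L \<subseteq> lists \<Sigma>" using L_sub by (auto simp: nonempty_words_def)
    show "0 < ?k" by simp
    fix w\<^sub>1 w\<^sub>2
    assume "w\<^sub>1 \<in> lists \<Sigma>" "w\<^sub>2 \<in> lists \<Sigma>" and
      "pref ?k w\<^sub>1 = pref ?k w\<^sub>2 \<and> infixes ?k w\<^sub>1 = infixes ?k w\<^sub>2 \<and> suff ?k w\<^sub>1 = suff ?k w\<^sub>2"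
    then show "w\<^sub>1 \<in> L \<longleftrightarrow> w\<^sub>2 \<in> L" by (intro test) (elim conjE, assumption)+
  qed
  ultimately show "L \<in> LT \<Sigma>" by (simp add: LT_def)
qed

section \<open>Renaming states\<close>

text \<open>\<open>DACA\<close> takes states and letters from one type, while the automaton built
  below has lists as states; hence the transport along an injection.\<close>

definition rename_daca :: "('b \<Rightarrow> 'a) \<Rightarrow> 'b daca \<Rightarrow> 'a daca" where
  "rename_daca f C =
    (let g = inv_into (states C) f in
     \<lparr>states = f ` states C, rule = \<lambda>x y z. f (rule C (g x) (g y) (g z)),
      alphabet = f ` alphabet C, inactive = f (inactive C),
      accept_states = f ` accept_states C, reject_states = f ` reject_states C\<rparr>)"

lemma rename_daca_simps [simp]:
  "states (rename_daca f C) = f ` states C"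
  "alphabet (rename_daca f C) = f ` alphabet C"
  "inactive (rename_daca f C) = f (inactive C)"
  "accept_states (rename_daca f C) = f ` accept_states C"
  "reject_states (rename_daca f C) = f ` reject_states C"
  "rule (rename_daca f C) x y z =
    f (rule C (inv_into (states C) f x) (inv_into (states C) f y) (inv_into (states C) f z))"
  by (simp_all add: rename_daca_def Let_def)

context
  fixes f :: "'b \<Rightarrow> 'a" and C :: "'b daca"
  assumes C: "is_daca C" and inj: "inj_on f (states C)"
begin

lemma rename_is_ca: "is_ca (rename_daca f C)"
proof -
  have ca: "is_ca C" using C by (simp add: is_daca_def)
  have iff: "f x = f y \<longleftrightarrow> x = y" if "x \<in> states C" "y \<in> states C" for x y
    using inj that by (auto dest: inj_onD)
  have "f (inactive C) \<notin> f ` alphabet C"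
    using ca iff unfolding is_ca_def by blast
  then show ?thesis
    using ca by (auto simp: is_ca_def inj iff)
qed

lemma rename_config_at:
  assumes w: "w \<in> lists (alphabet C)"
  shows "config_at (rename_daca f C) (map f w) \<tau> z = f (config_at C w \<tau> z)"
proof (induction \<tau> arbitrary: z)
  case 0
  then show ?case by (auto simp: config_at_def initial_config_def nat_less_iff)
next
  case (Suc \<tau>)
  have "config_at C w \<tau> z \<in> states C" for z
    using config_at_in_states C w by (auto simp: is_daca_def)
  then show ?case using Suc inj by (simp add: config_at_def global_map_def)
qed

lemma rename_final_config:
  assumes w: "w \<in> lists (alphabet C)" and F: "F \<subseteq> states C"
  shows "final_config (rename_daca f C) (f ` F) (config_at (rename_daca f C) (map f w) \<tau>) \<longleftrightarrow>
    final_config C F (config_at C w \<tau>)"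
proof -
  have ca: "is_ca C" using C by (simp add: is_daca_def)
  have sub: "F \<union> {inactive C} \<subseteq> states C" using F ca by (auto simp: is_ca_def)
  have "f (config_at C w \<tau> z) \<in> f ` (F \<union> {inactive C}) \<longleftrightarrow> config_at C w \<tau> z \<in> F \<union> {inactive C}" for z
    using inj_on_image_mem_iff[OF inj config_at_in_states[OF ca w] sub] .
  then show ?thesis by (simp add: final_config_def rename_config_at[OF w])
qed

lemma rename_final_at:
  assumes "w \<in> lists (alphabet C)"
  shows "accept_final_at (rename_daca f C) (map f w) \<tau> \<longleftrightarrow> accept_final_at C w \<tau>"
    and "reject_final_at (rename_daca f C) (map f w) \<tau> \<longleftrightarrow> reject_final_at C w \<tau>"
proof -
  have "accept_states C \<subseteq> states C" "reject_states C \<subseteq> states C"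
    using C by (auto simp: is_daca_def)
  then show "accept_final_at (rename_daca f C) (map f w) \<tau> \<longleftrightarrow> accept_final_at C w \<tau>"
    "reject_final_at (rename_daca f C) (map f w) \<tau> \<longleftrightarrow> reject_final_at C w \<tau>"
    by (simp_all add: rename_final_config[OF assms])
qed

lemma rename_nonempty_words:
  "nonempty_words (alphabet (rename_daca f C)) = map f ` nonempty_words (alphabet C)"
  by (auto simp: nonempty_words_def lists_image)

lemma rename_is_daca: "is_daca (rename_daca f C)"
proof -
  have sub: "accept_states C \<subseteq> states C" "reject_states C \<subseteq> states C" "inactive C \<in> states C"
    "inactive C \<notin> accept_states C" "inactive C \<notin> reject_states C"
    using C by (auto simp: is_daca_def is_ca_def)
  have "f ` accept_states C \<inter> f ` reject_states C = {}"
    using inj_on_image_Int[OF inj sub(1,2)] C by (simp add: is_daca_def)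
  moreover have "f (inactive C) \<notin> f ` accept_states C" "f (inactive C) \<notin> f ` reject_states C"
    using inj_on_image_mem_iff[OF inj] sub by auto
  moreover have "\<exists>\<tau>. accept_final_at (rename_daca f C) w \<tau> \<or> reject_final_at (rename_daca f C) w \<tau>"
    if w: "w \<in> nonempty_words (alphabet (rename_daca f C))" for w
  proof -
    obtain v where v: "w = map f v" "v \<in> nonempty_words (alphabet C)"
      using w unfolding rename_nonempty_words by blast
    then have "v \<in> lists (alphabet C)" by (simp add: nonempty_words_def)
    with v show ?thesis using C unfolding v(1) rename_final_at[OF \<open>v \<in> lists (alphabet C)\<close>]
      by (auto simp: is_daca_def)
  qed
  ultimately show ?thesis
    using C sub rename_is_ca unfolding is_daca_def rename_daca_simps by (simp add: subset_Diff_insert image_mono)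
qed

lemma rename_language: "language (rename_daca f C) = map f ` language C"
proof -
  have "accepts (rename_daca f C) (map f w) \<longleftrightarrow> accepts C w" if "w \<in> nonempty_words (alphabet C)" for w
    using that rename_final_at[of w] by (auto simp: accepts_def nonempty_words_def)
  then show ?thesis unfolding language_def rename_nonempty_words by auto
qed

lemma rename_decision_time:
  assumes "w \<in> nonempty_words (alphabet C)"
  shows "decision_time (rename_daca f C) (map f w) = decision_time C w"
  using assms rename_final_at[of w] by (simp add: decision_time_def nonempty_words_def)

end

text \<open>Used with \<open>g a = [a]\<close>: states that encode letters are renamed to these
  letters, which restores the original alphabet, and the other states get fresh symbols, of which an
  infinite type has enough.\<close>

lemma extend_to_injection:
  fixes g :: "'a::infinite \<Rightarrow> 'b"
  assumes "finite S" "finite A" "inj_on g A"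
  obtains f where "inj_on f S" "\<And>a. a \<in> A \<Longrightarrow> f (g a) = a"
proof -
  have "infinite (UNIV - A)" using assms(2) infinite_UNIV by simp
  then obtain B where B: "finite B" "card B = card (S - g ` A)" "B \<subseteq> UNIV - A"
    using infinite_arbitrarily_large by blast
  then obtain h where h: "bij_betw h (S - g ` A) B"
    using assms(1) by (metis finite_Diff finite_same_card_bij)
  define f where "f x = (if x \<in> g ` A then inv_into A g x else h x)" for x
  have hB: "h x \<notin> A" if "x \<in> S - g ` A" for x
    using h B(3) that by (auto simp: bij_betw_def)
  have "inj_on f S"
  proof (rule inj_onI)
    fix x y assume xy: "x \<in> S" "y \<in> S" "f x = f y"
    have inA: "inv_into A g v \<in> A" if "v \<in> g ` A" for v using that by (rule inv_into_into)
    show "x = y"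
      using xy hB[of x] hB[of y] inA[of x] inA[of y] h
      by (auto simp: f_def bij_betw_def assms(3) inj_on_eq_iff split: if_splits)
  qed
  moreover have "f (g a) = a" if "a \<in> A" for a
    using that assms(3) by (simp add: f_def)
  ultimately show thesis using that by blast
qed

section \<open>A window-collecting automaton\<close>

text \<open>Even lengths are included, which leaves room for the spare states of the
  automaton.\<close>

definition window_states :: "'a set \<Rightarrow> 'a \<Rightarrow> nat \<Rightarrow> 'a list set" where
  "window_states \<Sigma> q T = {u. set u \<subseteq> insert q \<Sigma> \<and> length u \<le> 2 * T + 1}"

text \<open>
  In step \<open>t \<le> T\<close> an active cell stores its window of radius \<open>t\<close>, so that the length of the state
  doubles as a clock.  The states \<open>[]\<close> and \<open>[q, q]\<close> are unreachable; they keep the accept and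
  reject sets nonempty.
\<close>

definition window_daca ::
  "'a set \<Rightarrow> 'a \<Rightarrow> nat \<Rightarrow> nat \<Rightarrow> 'a list set list \<Rightarrow> 'a list set set \<Rightarrow> 'a list daca" where
  "window_daca \<Sigma> q k T Vs \<A> =
     \<lparr>states = window_states \<Sigma> q T,
      rule = \<lambda>x y z. if y = [q] then [q]
        else if hd x # y @ [last z] \<in> window_states \<Sigma> q T then hd x # y @ [last z] else y,
      alphabet = (\<lambda>a. [a]) ` \<Sigma>,
      inactive = [q],
      accept_states = insert [] {u \<in> window_states \<Sigma> q T. \<exists>i<length Vs.
        length u = 2 * (k + i) + 1 \<and> take (2 * k + 1) (drop i u) \<in> Vs ! i \<and> Vs ! i \<in> \<A>},
      reject_states = insert [q, q] {u \<in> window_states \<Sigma> q T. \<exists>i<length Vs.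
        length u = 2 * (k + i) + 1 \<and> take (2 * k + 1) (drop i u) \<in> Vs ! i \<and> Vs ! i \<notin> \<A>}\<rparr>"

lemma finite_window_states: "finite \<Sigma> \<Longrightarrow> finite (window_states \<Sigma> q T)"
  unfolding window_states_def by (rule finite_lists_length_le) simp

lemma hd_window: "hd (window r c z) = c (z - int r)"
  by (simp add: window_def upt_conv_Cons del: upt_Suc)

lemma last_window: "last (window r c z) = c (z + int r)"
  by (simp add: window_def algebra_simps)

text \<open>The recursion that the local rule carries out: each neighbour contributes one outermost
  symbol.\<close>

lemma window_Suc:
  "window (Suc r) c z = hd (window r c (z - 1)) # window r c z @ [last (window r c (z + 1))]"
proof -
  have "[0..<2 * Suc r + 1] = [0..<Suc (2 * r + 1)] @ [2 * r + 2]"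
    by simp
  also have "[0..<Suc (2 * r + 1)] = 0 # map Suc [0..<2 * r + 1]"
    by (simp only: upt_conv_Cons[OF zero_less_Suc] map_Suc_upt)
  finally have *: "[0..<2 * Suc r + 1] = 0 # map Suc [0..<2 * r + 1] @ [2 * r + 2]"
    by (simp only: append_Cons)
  show ?thesis
    unfolding hd_window last_window
    unfolding window_def * by (simp add: algebra_simps del: upt_Suc)
qed

text \<open>Lets a cell in step \<open>k + i\<close> still read its window of radius
  \<open>k\<close>.\<close>

lemma take_drop_window: "take (2 * k + 1) (drop i (window (k + i) c z)) = window k c z"
  by (rule nth_equalityI) (auto simp: window_def algebra_simps simp del: upt_Suc)

lemma padded_in_insert: "w \<in> lists \<Sigma> \<Longrightarrow> padded q w i \<in> insert q \<Sigma>"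
  by (auto simp: padded_def in_lists_conv_set)

lemma window_in_window_states:
  assumes "w \<in> lists \<Sigma>" "t \<le> T"
  shows "window t (padded q w) z \<in> window_states \<Sigma> q T"
proof -
  have "set (window t (padded q w) z) \<subseteq> insert q \<Sigma>"
    unfolding window_def set_map using padded_in_insert[OF assms(1), of q] by blast
  then show ?thesis using assms(2) by (simp add: window_states_def)
qed

section \<open>Correctness of the window-collecting automaton\<close>

context
  fixes \<Sigma> :: "'a set" and q :: 'a and k T :: nat and Vs :: "'a list set list" and \<A> :: "'a list set set"
  assumes fin: "finite \<Sigma>" and q: "q \<notin> \<Sigma>" and k: "0 < k" and T: "k + length Vs \<le> T"
begin

abbreviation "WD \<equiv> window_daca \<Sigma> q k T Vs \<A>"

lemma window_daca_is_ca: "is_ca WD"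
  using finite_window_states[OF fin] q
  by (auto simp: is_ca_def window_daca_def) (auto simp: window_states_def)

lemma window_daca_rule:
  "rule WD x y z = (if y = [q] then [q]
    else if hd x # y @ [last z] \<in> window_states \<Sigma> q T then hd x # y @ [last z] else y)"
  by (simp add: window_daca_def)

lemma window_daca_config_at:
  assumes w: "w \<in> lists \<Sigma>" and "t \<le> T"
  shows "config_at WD (map (\<lambda>a. [a]) w) t z =
    (if 0 \<le> z \<and> z < int (length w) then window t (padded q w) z else [q])"
  using \<open>t \<le> T\<close>
proof (induction t arbitrary: z)
  case 0
  show ?case
    by (auto simp: config_at_def initial_config_def window_daca_def window_def padded_def nat_less_iff)
next
  case (Suc t)
  let ?c = "config_at WD (map (\<lambda>a. [a]) w) t"
  have IH: "?c z = (if 0 \<le> z \<and> z < int (length w) then window t (padded q w) z else [q])" for z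
    using Suc by simp
  have step: "config_at WD (map (\<lambda>a. [a]) w) (Suc t) z = rule WD (?c (z - 1)) (?c z) (?c (z + 1))"
    by (simp add: config_at_def global_map_def)
  show ?case
  proof (cases "0 \<le> z \<and> z < int (length w)")
    case True
    \<comment> \<open>Beyond the border the neighbour holds \<open>[q]\<close> instead of its
      window, but both start with the padding symbol.\<close>
    have "hd (?c (z - 1)) = hd (window t (padded q w) (z - 1))"
      using True by (auto simp: IH hd_window padded_def)
    moreover have "last (?c (z + 1)) = last (window t (padded q w) (z + 1))"
      using True by (auto simp: IH last_window padded_def)
    moreover have "?c z = window t (padded q w) z" using True by (simp add: IH)
    \<comment> \<open>The rule must not take an active cell for an inactive one: only the window of
      radius 0 has length 1, and its entry is a letter.\<close>
    moreover have "window t (padded q w) z \<noteq> [q]"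
    proof
      assume eq: "window t (padded q w) z = [q]"
      then have "length (window t (padded q w) z) = 1" by simp
      then have "t = 0" by simp
      then have "w ! nat z = q" using eq True by (simp add: window_def padded_def)
      moreover have "w ! nat z \<in> \<Sigma>"
        using w True nth_mem[of "nat z" w] by (auto simp: in_lists_conv_set)
      ultimately show False using q by simp
    qed
    moreover have "window (Suc t) (padded q w) z \<in> window_states \<Sigma> q T"
      using window_in_window_states[OF w Suc.prems] .
    ultimately show ?thesis
      unfolding step using True by (simp add: window_daca_rule window_Suc)
  next
    case False
    then show ?thesis unfolding step by (auto simp: IH window_daca_rule)
  qed
qed

lemma window_daca_final_at:
  assumes w: "w \<in> lists \<Sigma>" "w \<noteq> []" and t: "t \<le> T"
  shows "accept_final_at WD (map (\<lambda>a. [a]) w) t \<longleftrightarrow>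
      (\<exists>i<length Vs. t = k + i \<and> windows q k w \<subseteq> Vs ! i \<and> Vs ! i \<in> \<A>)" (is ?A)
    and "reject_final_at WD (map (\<lambda>a. [a]) w) t \<longleftrightarrow>
      (\<exists>i<length Vs. t = k + i \<and> windows q k w \<subseteq> Vs ! i \<and> Vs ! i \<notin> \<A>)" (is ?R)
proof -
  let ?win = "\<lambda>t. window t (padded q w)"
  \<comment> \<open>Odd length excludes \<open>[]\<close> and \<open>[q, q]\<close>.\<close>
  have active: "?win t z \<noteq> [q] \<and> ?win t z \<noteq> [] \<and> ?win t z \<noteq> [q, q]"
    if "0 \<le> z" "z < int (length w)" for z
  proof -
    have "w ! nat z \<in> \<Sigma>" using w that by (simp add: in_lists_conv_set)
    then have "?win t z \<noteq> [q]" if "t = 0"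
      using that q \<open>0 \<le> z\<close> \<open>z < int (length w)\<close> by (auto simp: window_def padded_def)
    moreover have "length (?win t z) = 2 * t + 1" by simp
    ultimately show ?thesis by (cases "t = 0") (auto dest: arg_cong[of _ _ length])
  qed
  have inactive: "inactive WD = [q]" by (simp add: window_daca_def)
  have final: "final_config WD F (config_at WD (map (\<lambda>a. [a]) w) t) \<longleftrightarrow>
      (\<forall>z\<in>{0..<int (length w)}. ?win t z \<in> F)" for F
    using active by (auto simp: final_config_def window_daca_config_at[OF w(1) t] inactive)
  \<comment> \<open>The length acts as the clock and forces \<open>t = k + i\<close>.\<close>
  have mem: "(length (?win t z) = 2 * (k + i) + 1 \<and> take (2 * k + 1) (drop i (?win t z)) \<in> V \<and> P)
      \<longleftrightarrow> (t = k + i \<and> ?win k z \<in> V \<and> P)" for i z V P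
    using take_drop_window[of k i "padded q w" z] by (cases "t = k + i") auto
  have acc: "?win t z \<in> accept_states WD \<longleftrightarrow>
      (\<exists>i<length Vs. t = k + i \<and> ?win k z \<in> Vs ! i \<and> Vs ! i \<in> \<A>)"
    if "z \<in> {0..<int (length w)}" for z
    unfolding window_daca_def daca.simps insert_iff mem_Collect_eq mem
    using active[of z] that window_in_window_states[OF w(1) t] by simp
  have rej: "?win t z \<in> reject_states WD \<longleftrightarrow>
      (\<exists>i<length Vs. t = k + i \<and> ?win k z \<in> Vs ! i \<and> Vs ! i \<notin> \<A>)"
    if "z \<in> {0..<int (length w)}" for z
    unfolding window_daca_def daca.simps insert_iff mem_Collect_eq mem
    using active[of z] that window_in_window_states[OF w(1) t] by simp
  \<comment> \<open>All cells share the clock, so \<open>i\<close> is the same for each of them and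
    the quantifiers can be swapped; cell 0 ensures that such an \<open>i\<close> exists.\<close>
  have "0 \<in> {0..<int (length w)}" using w by simp
  then have *: "(\<forall>z\<in>{0..<int (length w)}. \<exists>i<length Vs. t = k + i \<and> ?win k z \<in> Vs ! i \<and> P i) \<longleftrightarrow>
      (\<exists>i<length Vs. t = k + i \<and> windows q k w \<subseteq> Vs ! i \<and> P i)" for P
    unfolding windows_def by (cases "\<exists>i<length Vs. t = k + i") (force, blast)
  show ?A unfolding final *[symmetric] by (rule ball_cong[OF refl acc])
  show ?R unfolding final *[symmetric] by (rule ball_cong[OF refl rej])
qed

lemma window_daca_decides:
  assumes sorted: "sorted (map card Vs)" and dist: "distinct Vs" and finV: "\<And>V. V \<in> set Vs \<Longrightarrow> finite V"
    and w: "w \<in> lists \<Sigma>" "w \<noteq> []" and mem: "windows q k w \<in> set Vs"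
  obtains t where "t \<le> T"
    "\<And>t'. t' < t \<Longrightarrow> \<not> accept_final_at WD (map (\<lambda>a. [a]) w) t'"
    "\<And>t'. t' < t \<Longrightarrow> \<not> reject_final_at WD (map (\<lambda>a. [a]) w) t'"
    "accept_final_at WD (map (\<lambda>a. [a]) w) t \<longleftrightarrow> windows q k w \<in> \<A>"
    "reject_final_at WD (map (\<lambda>a. [a]) w) t \<longleftrightarrow> windows q k w \<notin> \<A>"
proof -
  obtain j where j: "j < length Vs" "Vs ! j = windows q k w"
    using mem by (auto simp: in_set_conv_nth)
  \<comment> \<open>An earlier superset has at most as many elements, so by finiteness it equals the
    window set, against distinctness.\<close>
  have first: "j \<le> i" if "i < length Vs" "windows q k w \<subseteq> Vs ! i" for i
  proof (rule ccontr)
    assume "\<not> j \<le> i"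
    then have "card (Vs ! i) \<le> card (Vs ! j)"
      using sorted_nth_mono[OF sorted, of i j] j by simp
    then have "Vs ! j = Vs ! i"
      using that finV[of "Vs ! i"] by (simp add: card_seteq j(2))
    then show False using dist j that \<open>\<not> j \<le> i\<close> by (auto simp: nth_eq_iff_index_eq)
  qed
  have jT: "k + j \<le> T" using j T by simp
  show thesis
  proof (rule that[OF jT])
    show "accept_final_at WD (map (\<lambda>a. [a]) w) (k + j) \<longleftrightarrow> windows q k w \<in> \<A>"
      "reject_final_at WD (map (\<lambda>a. [a]) w) (k + j) \<longleftrightarrow> windows q k w \<notin> \<A>"
      using window_daca_final_at[OF w jT] j by auto
    fix t' assume t': "t' < k + j"
    then have "t' \<le> T" using jT by simp
    then show "\<not> accept_final_at WD (map (\<lambda>a. [a]) w) t'"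
      "\<not> reject_final_at WD (map (\<lambda>a. [a]) w) t'"
      using window_daca_final_at[OF w, of t'] first t' by fastforce+
  qed
qed

lemma window_daca_is_daca:
  assumes "\<And>w. w \<in> lists \<Sigma> \<Longrightarrow> w \<noteq> [] \<Longrightarrow>
    \<exists>t. accept_final_at WD (map (\<lambda>a. [a]) w) t \<or> reject_final_at WD (map (\<lambda>a. [a]) w) t"
  shows "is_daca WD"
proof -
  have "\<exists>t. accept_final_at WD v t \<or> reject_final_at WD v t"
    if "v \<in> nonempty_words (alphabet WD)" for v
  proof -
    have "v \<in> map (\<lambda>a. [a]) ` lists \<Sigma>" "v \<noteq> []"
      using that by (auto simp: nonempty_words_def window_daca_def lists_image)
    then show ?thesis using assms by auto
  qed
  \<comment> \<open>The length of a state fixes \<open>i\<close> and thereby the one set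
    \<open>Vs ! i\<close> whose status counts; the two spare states have even length.\<close>
  moreover have "accept_states WD \<inter> reject_states WD = {}"
    by (auto simp: window_daca_def) presburger
  \<comment> \<open>\<open>[q, q]\<close> fits since \<open>T\<close> is positive;
    \<open>[q]\<close> is in neither set, because apart from the spare states all members have
    length at least 3.\<close>
  moreover have "accept_states WD \<subseteq> states WD - {inactive WD}" "reject_states WD \<subseteq> states WD - {inactive WD}"
    using k T by (auto simp: window_daca_def) (auto simp: window_states_def)
  moreover have "accept_states WD \<noteq> {}" "reject_states WD \<noteq> {}"
    by (auto simp: window_daca_def)
  ultimately show ?thesis using window_daca_is_ca unfolding is_daca_def by blast
qed

end

section \<open>Locally testable languages are decided in constant time\<close>

text \<open>The infinite type supplies an inactive symbol outside \<Sigma> and fresh names for the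
  states.\<close>

lemma LT_subset_DACA_const:
  fixes \<Sigma> :: "'a::infinite set"
  assumes fin: "finite \<Sigma>"
  shows "LT \<Sigma> \<subseteq> DACA_const \<Sigma>"
proof
  fix L assume "L \<in> LT \<Sigma>"
  then obtain k where L: "L \<subseteq> nonempty_words \<Sigma>" and k: "0 < k"
    and test: "\<And>w\<^sub>1 w\<^sub>2. \<lbrakk>w\<^sub>1 \<in> lists \<Sigma>; w\<^sub>2 \<in> lists \<Sigma>; pref k w\<^sub>1 = pref k w\<^sub>2;
      infixes k w\<^sub>1 = infixes k w\<^sub>2; suff k w\<^sub>1 = suff k w\<^sub>2\<rbrakk> \<Longrightarrow> w\<^sub>1 \<in> L \<longleftrightarrow> w\<^sub>2 \<in> L"
    unfolding LT_def locally_testable_def by blast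
  obtain q where q: "q \<notin> \<Sigma>" using ex_new_if_finite[OF infinite_UNIV fin] by blast
  \<comment> \<open>Words with equal window sets pass the same test, so the window sets of the words
    in \<open>L\<close> can serve as the accepting candidates.\<close>
  have windows_L: "windows q k w \<in> windows q k ` L \<longleftrightarrow> w \<in> L" if w: "w \<in> lists \<Sigma>" for w
  proof
    assume "windows q k w \<in> windows q k ` L"
    then obtain v where v: "v \<in> L" "windows q k w = windows q k v" by blast
    have "v \<in> lists \<Sigma>" using v L by (auto simp: nonempty_words_def)
    moreover from this w have "q \<notin> set w" "q \<notin> set v" using q by (auto simp: in_lists_conv_set)
    ultimately show "w \<in> L"
      using test[OF w _ pref_eq_if_windows_eq[OF k _ _ v(2)] infixes_eq_if_windows_eq[OF k _ _ v(2)]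
          suff_eq_if_windows_eq[OF k _ _ v(2)]] v(1)
      by simp
  qed simp

  \<comment> \<open>This finite set contains every window of radius \<open>k\<close>, so its power
    set contains every window set that can occur.\<close>
  let ?U = "window_states \<Sigma> q k"
  have finU: "finite ?U" using fin by (rule finite_window_states)
  then obtain Vs\<^sub>0 where Vs\<^sub>0: "set Vs\<^sub>0 = Pow ?U" "distinct Vs\<^sub>0"
    using finite_distinct_list[of "Pow ?U"] by auto
  define Vs where "Vs = sort_key card Vs\<^sub>0"
  have Vs: "set Vs = Pow ?U" "distinct Vs" "sorted (map card Vs)"
    using Vs\<^sub>0 by (auto simp: Vs_def)
  define T where "T = k + length Vs"
  define D where "D = window_daca \<Sigma> q k T Vs (windows q k ` L)"
  let ?s = "map (\<lambda>a. [a])"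
  have decided: "\<exists>t\<le>T. (\<forall>t'<t. \<not> accept_final_at D (?s w) t' \<and> \<not> reject_final_at D (?s w) t') \<and>
      (accept_final_at D (?s w) t \<longleftrightarrow> w \<in> L) \<and> (reject_final_at D (?s w) t \<longleftrightarrow> w \<notin> L)"
    if w: "w \<in> lists \<Sigma>" "w \<noteq> []" for w
  proof -
    have "windows q k w \<in> set Vs"
      using window_in_window_states[OF w(1), of k k q] by (auto simp: Vs(1) windows_def)
    moreover have "finite V" if "V \<in> set Vs" for V
      using that finU finite_subset by (auto simp: Vs(1))
    ultimately show ?thesis
      using window_daca_decides[OF fin q k _ Vs(3,2) _ w, of T "windows q k ` L"] windows_L[OF w(1)]
      unfolding D_def T_def by (metis order_refl)
  qed
  have D: "is_daca D"
    unfolding D_def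
  proof (rule window_daca_is_daca[OF fin q k])
    show "k + length Vs \<le> T" by (simp add: T_def)
    fix w assume "w \<in> lists \<Sigma>" "w \<noteq> []"
    from decided[OF this] show "\<exists>t. accept_final_at (window_daca \<Sigma> q k T Vs (windows q k ` L)) (?s w) t \<or>
        reject_final_at (window_daca \<Sigma> q k T Vs (windows q k ` L)) (?s w) t"
      unfolding D_def by blast
  qed
  have alph: "alphabet D = (\<lambda>a. [a]) ` \<Sigma>" by (simp add: D_def window_daca_def)
  have words: "nonempty_words (alphabet D) = ?s ` nonempty_words \<Sigma>"
    unfolding alph nonempty_words_def lists_image by auto
  have acc: "accepts D (?s w) \<longleftrightarrow> w \<in> L" and time: "decision_time D (?s w) \<le> T"
    if w: "w \<in> nonempty_words \<Sigma>" for w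
  proof -
    obtain t where t: "t \<le> T"
      "\<And>t'. t' < t \<Longrightarrow> \<not> accept_final_at D (?s w) t'"
      "\<And>t'. t' < t \<Longrightarrow> \<not> reject_final_at D (?s w) t'"
      "accept_final_at D (?s w) t \<longleftrightarrow> w \<in> L" "reject_final_at D (?s w) t \<longleftrightarrow> w \<notin> L"
      using decided[of w] w by (auto simp: nonempty_words_def)
    \<comment> \<open>Nothing is final before \<open>t\<close>, and if \<open>w\<close> is not in
      \<open>L\<close>, the rejection at \<open>t\<close> blocks all later acceptance.\<close>
    show "accepts D (?s w) \<longleftrightarrow> w \<in> L"
      unfolding accepts_def using t(2-5) by (metis linorder_neqE_nat)
    have "decision_time D (?s w) \<le> t"
      unfolding decision_time_def by (rule Least_le) (use t(4,5) in blast)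
    then show "decision_time D (?s w) \<le> T" using t(1) by simp
  qed
  have lang: "language D = ?s ` L"
    unfolding language_def words using acc L by auto

  have "finite (states D)" using D by (simp add: is_daca_def is_ca_def)
  then obtain f where f: "inj_on f (states D)" "\<And>a. a \<in> \<Sigma> \<Longrightarrow> f [a] = a"
    using extend_to_injection[of "states D" \<Sigma> "\<lambda>a. [a]"] fin by (auto simp: inj_on_def)
  have fs: "map f (?s w) = w" if "w \<in> lists \<Sigma>" for w
    using that f(2) by (simp add: map_idI in_lists_conv_set)
  let ?E = "rename_daca f D"
  have "alphabet ?E = \<Sigma>" using f(2) by (simp add: alph image_image)
  moreover have "language ?E = L"
  proof -
    have "map f ` ?s ` L = (\<lambda>w. w) ` L"
      unfolding image_image by (rule image_cong) (use fs L in \<open>auto simp: nonempty_words_def\<close>)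
    then show ?thesis by (simp add: rename_language[OF D f(1)] lang)
  qed
  moreover have "decision_time ?E w \<le> T" if w: "w \<in> nonempty_words \<Sigma>" for w
  proof -
    have "map f (?s w) = w" using fs w by (simp add: nonempty_words_def)
    moreover have "?s w \<in> nonempty_words (alphabet D)" using w words by blast
    ultimately show ?thesis
      using rename_decision_time[OF D f(1), of "?s w"] time[OF w] by simp
  qed
  ultimately have "L \<in> DACA \<Sigma> (\<lambda>_. T)"
    unfolding DACA_def using rename_is_daca[OF D f(1)] by blast
  then show "L \<in> DACA_const \<Sigma>" by (auto simp: DACA_const_def)
qed

theorem theorem8:
  fixes \<Sigma> :: "'a::infinite set"
  assumes "finite \<Sigma>"
  shows "DACA_const \<Sigma> = LT \<Sigma>"
  using DACA_const_subset_LT LT_subset_DACA_const[OF assms] by blast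

end
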